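(* Let $\mathbf{C}$ be an antilinear operator on $L^2(\mathbb{C}^2)=L^2\oplus L^2$. Then $\mathbf{C}=\begin{bmatrix} D_1 & D_2\\ D_2^\sharp & D_4\end{bmatrix}$ (with $D_1,D_2,D_4$ bounded antilinear operators on $L^2$) is a conjugation such that $\mathbf{M}_z\mathbf{C}=\mathbf{C}\mathbf{M}_{\bar z}$ if and only if there are functions $\psi_i\in L^\infty$, $i=1,2,4$, such that $D_i=M_{\psi_i}\tilde J$ and $$|\psi_1|^2=|\psi_4|^2=1-|\psi_2|^2,$$ $$\overline{\psi_1}\psi_2+\overline{\psi_2}\psi_4=0$$ (a.e. on $\mathbb{T}$).
   Context: $L^2=L^2(\mathbb{T},m)$ and $L^\infty=L^\infty(\mathbb{T},m)$, with $\mathbb{T}$ the unit circle and $m$ normalized Lebesgue measure (complex-valued functions). A conjugation on a Hilbert space $\mathcal{K}$ is an antilinear map $C:\mathcal{K}\to\mathcal{K}$ with $C^2=I$ and $\langle Cf,Cg\rangle=\langle g,f\rangle$ for all $f,g$. For a bounded antilinear operator $A$, its antilinear adjoint $A^\sharp$ is the unique antilinear operator with $\langle Af,g\rangle=\overline{\langle f,A^\sharp g\rangle}$ for all $f,g$. $\tilde J f=\bar f$ for $f\in L^2$. $M_\psi$ is multiplication by $\psi$ on $L^2$; $\mathbf{M}_z$ and $\mathbf{M}_{\bar z}$ are the operators of multiplication by $z$ and $\bar z$ in each component of $L^2\oplus L^2$. *)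

theory Defs
  imports "HOL-Analysis.Analysis"
begin

section \<open>Complex inner product spaces\<close>

text \<open>
  The inner product \<open>cinner\<close> is linear in the first and antilinear in the second argument.
  The real inner product, and hence norm and topology, are those induced by \<open>cinner\<close>.
\<close>

class complex_inner = real_inner +
  fixes scaleC :: "complex \<Rightarrow> 'a \<Rightarrow> 'a"  (infixr \<open>*\<^sub>C\<close> 75)
    and cinner :: "'a \<Rightarrow> 'a \<Rightarrow> complex"
  assumes scaleC_add_right: "a *\<^sub>C (x + y) = a *\<^sub>C x + a *\<^sub>C y"
    and scaleC_add_left: "(a + b) *\<^sub>C x = a *\<^sub>C x + b *\<^sub>C x"
    and scaleC_scaleC: "a *\<^sub>C (b *\<^sub>C x) = (a * b) *\<^sub>C x"
    and scaleC_of_real: "complex_of_real r *\<^sub>C x = r *\<^sub>R x"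
    and cinner_commute: "cinner x y = cnj (cinner y x)"
    and cinner_add_left: "cinner (x + y) z = cinner x z + cinner y z"
    and cinner_scaleC_left: "cinner (a *\<^sub>C x) y = a * cinner x y"
    and inner_eq_Re_cinner: "inner x y = Re (cinner x y)"

instantiation prod :: (complex_inner, complex_inner) complex_inner
begin

definition scaleC_prod_def: "a *\<^sub>C x = (a *\<^sub>C fst x, a *\<^sub>C snd x)"

definition cinner_prod_def: "cinner x y = cinner (fst x) (fst y) + cinner (snd x) (snd y)"

instance
proof
  fix x y :: "'a \<times> 'b"
  show "cinner x y = cnj (cinner y x)"
    unfolding cinner_prod_def
    by (simp add: cinner_commute[of "fst x"] cinner_commute[of "snd x"])
qed (auto simp: scaleC_prod_def cinner_prod_def scaleC_add_right scaleC_add_left scaleC_scaleC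
      scaleC_of_real cinner_add_left cinner_scaleC_left inner_prod_def inner_eq_Re_cinner
      algebra_simps prod_eq_iff)

end

section \<open>Antilinear operators\<close>

definition antilinear :: "('a::complex_inner \<Rightarrow> 'b::complex_inner) \<Rightarrow> bool" where
  "antilinear A \<longleftrightarrow> (\<forall>f g. A (f + g) = A f + A g) \<and> (\<forall>a f. A (a *\<^sub>C f) = cnj a *\<^sub>C A f)"

definition bounded_antilinear :: "('a::complex_inner \<Rightarrow> 'b::complex_inner) \<Rightarrow> bool" where
  "bounded_antilinear A \<longleftrightarrow> antilinear A \<and> (\<exists>K. \<forall>f. norm (A f) \<le> K * norm f)"

definition conjugation :: "('a::complex_inner \<Rightarrow> 'a) \<Rightarrow> bool" where
  "conjugation C \<longleftrightarrow> antilinear C \<and> (\<forall>f. C (C f) = f) \<and> (\<forall>f g. cinner (C f) (C g) = cinner g f)"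

definition is_antilinear_adjoint ::
    "('a::complex_inner \<Rightarrow> 'b::complex_inner) \<Rightarrow> ('b \<Rightarrow> 'a) \<Rightarrow> bool" where
  "is_antilinear_adjoint A B \<longleftrightarrow> antilinear B \<and> (\<forall>f g. cinner (A f) g = cnj (cinner f (B g)))"

lemma is_antilinear_adjoint_unique:
  assumes "is_antilinear_adjoint A B" "is_antilinear_adjoint A B'"
  shows "B = B'"
proof
  fix g
  have *: "cinner f (B g) = cinner f (B' g)" for f
    using assms unfolding is_antilinear_adjoint_def by (metis complex_cnj_cnj)
  have "inner (B g - B' g) (B g - B' g) = 0"
  proof -
    have "inner (B g - B' g) (B g) = inner (B g - B' g) (B' g)"
      by (simp only: inner_eq_Re_cinner *)
    then show ?thesis
      by (simp only: inner_diff_right diff_self)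
  qed
  then show "B g = B' g" by simp
qed

text \<open>
  For a bounded antilinear operator on a Hilbert space the adjoint exists by the Riesz
  representation theorem; it is unique by the previous lemma.
\<close>

definition antilinear_adjoint ::
    "('a::complex_inner \<Rightarrow> 'b::complex_inner) \<Rightarrow> 'b \<Rightarrow> 'a"  (\<open>_\<^sup>\<sharp>\<close> [1000] 999) where
  "A\<^sup>\<sharp> = (THE B. is_antilinear_adjoint A B)"

definition block_op ::
    "('a::complex_inner \<Rightarrow> 'a) \<Rightarrow> ('a \<Rightarrow> 'a) \<Rightarrow> ('a \<Rightarrow> 'a) \<Rightarrow> ('a \<Rightarrow> 'a) \<Rightarrow> 'a \<times> 'a \<Rightarrow> 'a \<times> 'a" where
  "block_op A B C D = (\<lambda>(f, g). (A f + B g, C f + D g))"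

section \<open>The space $L^2$ of the unit circle\<close>

text \<open>
  Normalized arc length. Its space is the unit circle, so functions are represented by arbitrary
  functions on \<open>complex\<close> whose values off the circle are irrelevant. Measurability is with respect to
  the Borel sets, which yields the same almost-everywhere classes as the Lebesgue completion.
\<close>

definition circle_measure :: "complex measure" where
  "circle_measure =
     distr (uniform_measure lborel {0..2 * pi}) (restrict_space borel (sphere 0 1)) cis"

lemma space_circle_measure [simp]: "space circle_measure = sphere 0 1"
  by (simp add: circle_measure_def space_restrict_space)

lemma sets_circle_measure [measurable_cong]:
  "sets circle_measure = sets (restrict_space borel (sphere 0 1))"
  by (simp add: circle_measure_def)

lemma cis_measurable_circle: "cis \<in> lborel \<rightarrow>\<^sub>M restrict_space borel (sphere 0 1)"
  by (intro measurable_restrict_space2)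
    (auto simp: measurable_lborel1 intro!: borel_measurable_continuous_onI continuous_on_cis
      continuous_on_id)

lemma emeasure_circle_measure_space: "emeasure circle_measure (sphere 0 1) = 1"
proof -
  have "emeasure circle_measure (sphere 0 1) =
      emeasure (uniform_measure lborel {0..2 * pi}) (cis -` sphere 0 1 \<inter> UNIV)"
    unfolding circle_measure_def
    by (subst emeasure_distr) (use cis_measurable_circle in \<open>auto simp: sets_restrict_space
       measurable_def\<close>)
  also have "cis -` sphere 0 1 \<inter> UNIV = UNIV" by auto
  also have "emeasure (uniform_measure lborel {0..2 * pi}) UNIV = 1"
    by (subst emeasure_uniform_measure) (auto simp: ennreal_divide_self)
  finally show ?thesis .
qed

lemma borel_measurable_cnj [measurable]: "cnj \<in> borel_measurable borel"
  by (intro borel_measurable_continuous_onI continuous_intros)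

definition square_integrable :: "(complex \<Rightarrow> complex) \<Rightarrow> bool" where
  "square_integrable f \<longleftrightarrow>
     f \<in> borel_measurable circle_measure \<and> integrable circle_measure (\<lambda>z. (cmod (f z))\<^sup>2)"

definition eq_ae :: "(complex \<Rightarrow> complex) \<Rightarrow> (complex \<Rightarrow> complex) \<Rightarrow> bool" where
  "eq_ae f g \<longleftrightarrow>
     square_integrable f \<and> square_integrable g \<and> (AE z in circle_measure. f z = g z)"

lemma square_integrable_0 [simp]: "square_integrable (\<lambda>_. 0)"
  by (simp add: square_integrable_def)

lemma square_integrable_add:
  assumes "square_integrable f" "square_integrable g"
  shows "square_integrable (\<lambda>z. f z + g z)"
proof -
  have [measurable]: "f \<in> borel_measurable circle_measure" "g \<in> borel_measurable circle_measure"
    using assms by (auto simp: square_integrable_def)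
  have "integrable circle_measure (\<lambda>z. 2 * (cmod (f z))\<^sup>2 + 2 * (cmod (g z))\<^sup>2)"
    using assms by (auto simp: square_integrable_def)
  then have "integrable circle_measure (\<lambda>z. (cmod (f z + g z))\<^sup>2)"
  proof (rule Bochner_Integration.integrable_bound)
    show "AE z in circle_measure. norm ((cmod (f z + g z))\<^sup>2)
        \<le> norm (2 * (cmod (f z))\<^sup>2 + 2 * (cmod (g z))\<^sup>2)"
    proof (intro AE_I2)
      fix z
      have "(cmod (f z + g z))\<^sup>2 \<le> (cmod (f z) + cmod (g z))\<^sup>2"
        by (intro power_mono norm_triangle_ineq) auto
      also have "\<dots> \<le> 2 * (cmod (f z))\<^sup>2 + 2 * (cmod (g z))\<^sup>2"
        using sum_squares_bound[of "cmod (f z)" "cmod (g z)"] by (simp add: power2_sum)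
      finally show "norm ((cmod (f z + g z))\<^sup>2) \<le> norm (2 * (cmod (f z))\<^sup>2 + 2 * (cmod (g z))\<^sup>2)"
        by simp
    qed
  qed measurable
  then show ?thesis by (simp add: square_integrable_def)
qed

definition ess_bounded :: "(complex \<Rightarrow> complex) \<Rightarrow> bool" where
  "ess_bounded \<psi> \<longleftrightarrow>
     \<psi> \<in> borel_measurable circle_measure \<and> (\<exists>K. AE z in circle_measure. cmod (\<psi> z) \<le> K)"

lemma ess_bounded_const [simp]: "ess_bounded (\<lambda>_. c)"
  by (auto simp: ess_bounded_def)

lemma square_integrable_mult:
  assumes "ess_bounded \<psi>" "square_integrable f"
  shows "square_integrable (\<lambda>z. \<psi> z * f z)"
proof -
  have [measurable]: "f \<in> borel_measurable circle_measure" "\<psi> \<in> borel_measurable circle_measure"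
    using assms by (auto simp: square_integrable_def ess_bounded_def)
  obtain K where K: "AE z in circle_measure. cmod (\<psi> z) \<le> K"
    using assms by (auto simp: ess_bounded_def)
  have "integrable circle_measure (\<lambda>z. K\<^sup>2 * (cmod (f z))\<^sup>2)"
    using assms by (auto simp: square_integrable_def)
  then have "integrable circle_measure (\<lambda>z. (cmod (\<psi> z * f z))\<^sup>2)"
  proof (rule Bochner_Integration.integrable_bound)
    show "AE z in circle_measure. norm ((cmod (\<psi> z * f z))\<^sup>2) \<le> norm (K\<^sup>2 * (cmod (f z))\<^sup>2)"
      using K by eventually_elim
        (auto simp: norm_mult power_mult_distrib intro!: mult_right_mono power_mono)
  qed measurable
  then show ?thesis by (simp add: square_integrable_def)
qed

lemma square_integrable_cmult:
  "square_integrable f \<Longrightarrow> square_integrable (\<lambda>z. c * f z)"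
  by (rule square_integrable_mult[of "\<lambda>_. c"]) auto

lemma square_integrable_cnj:
  "square_integrable f \<Longrightarrow> square_integrable (\<lambda>z. cnj (f z))"
  unfolding square_integrable_def by (auto intro: measurable_compose[OF _ borel_measurable_cnj])

lemma integrable_mult_cnj:
  assumes "square_integrable f" "square_integrable g"
  shows "integrable circle_measure (\<lambda>z. f z * cnj (g z))"
proof -
  have [measurable]: "f \<in> borel_measurable circle_measure" "g \<in> borel_measurable circle_measure"
    using assms by (auto simp: square_integrable_def)
  have "integrable circle_measure (\<lambda>z. (cmod (f z))\<^sup>2 + (cmod (g z))\<^sup>2)"
    using assms by (auto simp: square_integrable_def)
  then show ?thesis
  proof (rule Bochner_Integration.integrable_bound)
    show "AE z in circle_measure. norm (f z * cnj (g z)) \<le> norm ((cmod (f z))\<^sup>2 + (cmod (g z))\<^sup>2)"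
    proof (intro AE_I2)
      fix z
      have "cmod (f z) * cmod (g z) \<le> (cmod (f z))\<^sup>2 + (cmod (g z))\<^sup>2"
        using sum_squares_bound[of "cmod (f z)" "cmod (g z)"]
          mult_nonneg_nonneg[OF norm_ge_zero norm_ge_zero, of "f z" "g z"]
        by linarith
      then show "norm (f z * cnj (g z)) \<le> norm ((cmod (f z))\<^sup>2 + (cmod (g z))\<^sup>2)"
        by (simp add: norm_mult)
    qed
  qed measurable
qed

quotient_type L2 = "complex \<Rightarrow> complex" / partial: eq_ae
proof (rule part_equivpI)
  show "\<exists>f. eq_ae f f"
    by (rule exI[of _ "\<lambda>_. 0"]) (simp add: eq_ae_def)
  show "symp eq_ae"
    by (auto intro!: sympI simp: eq_ae_def)
  show "transp eq_ae"
    by (auto intro!: transpI simp: eq_ae_def)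
qed

instantiation L2 :: complex_inner
begin

lift_definition zero_L2 :: L2 is "\<lambda>_. 0"
  by (simp add: eq_ae_def)

lift_definition plus_L2 :: "L2 \<Rightarrow> L2 \<Rightarrow> L2" is "\<lambda>f g z. f z + g z"
  by (auto simp: eq_ae_def square_integrable_add)

lift_definition scaleC_L2 :: "complex \<Rightarrow> L2 \<Rightarrow> L2" is "\<lambda>a f z. a * f z"
  by (auto simp: eq_ae_def square_integrable_cmult)

lift_definition cinner_L2 :: "L2 \<Rightarrow> L2 \<Rightarrow> complex"
  is "\<lambda>f g. \<integral>z. f z * cnj (g z) \<partial>circle_measure"
proof -
  fix f f' g g'
  assume *: "eq_ae f f'" "eq_ae g g'"
  then have [measurable]:
    "f \<in> borel_measurable circle_measure" "f' \<in> borel_measurable circle_measure"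
    "g \<in> borel_measurable circle_measure" "g' \<in> borel_measurable circle_measure"
    by (auto simp: eq_ae_def square_integrable_def)
  show "(\<integral>z. f z * cnj (g z) \<partial>circle_measure) = (\<integral>z. f' z * cnj (g' z) \<partial>circle_measure)"
  proof (rule integral_cong_AE)
    show "AE z in circle_measure. f z * cnj (g z) = f' z * cnj (g' z)"
      using * by (auto simp: eq_ae_def)
  qed measurable
qed

definition uminus_L2 :: "L2 \<Rightarrow> L2" where "uminus_L2 f = (-1) *\<^sub>C f"
definition minus_L2 :: "L2 \<Rightarrow> L2 \<Rightarrow> L2" where "minus_L2 f g = f + (-1) *\<^sub>C g"
definition scaleR_L2 :: "real \<Rightarrow> L2 \<Rightarrow> L2" where "scaleR_L2 r f = complex_of_real r *\<^sub>C f"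
definition inner_L2 :: "L2 \<Rightarrow> L2 \<Rightarrow> real" where "inner_L2 f g = Re (cinner f g)"
definition norm_L2 :: "L2 \<Rightarrow> real" where "norm_L2 f = sqrt (inner f f)"
definition dist_L2 :: "L2 \<Rightarrow> L2 \<Rightarrow> real" where "dist_L2 f g = norm (f - g)"
definition sgn_L2 :: "L2 \<Rightarrow> L2" where "sgn_L2 f = inverse (norm f) *\<^sub>R f"
definition uniformity_L2 :: "(L2 \<times> L2) filter" where
  "uniformity_L2 = (INF e\<in>{0 <..}. principal {(f, g). dist f g < e})"
definition open_L2 :: "L2 set \<Rightarrow> bool" where
  "open_L2 U = (\<forall>f\<in>U. eventually (\<lambda>(f', g). f' = f \<longrightarrow> g \<in> U) uniformity)"

instance
proof
  have sc_add_r: "a *\<^sub>C (x + y) = a *\<^sub>C x + a *\<^sub>C y" for a and x y :: L2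
    by transfer
      (auto simp: eq_ae_def algebra_simps intro!: square_integrable_add square_integrable_cmult)
  have sc_add_l: "(a + b) *\<^sub>C x = a *\<^sub>C x + b *\<^sub>C x" for a b and x :: L2
    by transfer
      (auto simp: eq_ae_def ring_distribs intro!: square_integrable_add square_integrable_cmult
        square_integrable_cmult[of _ "a + b", unfolded ring_distribs])
  have sc_sc: "a *\<^sub>C (b *\<^sub>C x) = (a * b) *\<^sub>C x" for a b and x :: L2
    by transfer (auto simp: eq_ae_def intro!: square_integrable_cmult)
  have sc_1: "1 *\<^sub>C x = x" for x :: L2
    by transfer (auto simp: eq_ae_def)
  have sc_0: "0 *\<^sub>C x = 0" for x :: L2
    by transfer (auto simp: eq_ae_def)
  have ci_comm: "cinner x y = cnj (cinner y x)" for x y :: L2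
  proof transfer
    fix f g :: "complex \<Rightarrow> complex"
    have "(\<lambda>z. f z * cnj (g z)) = (\<lambda>z. cnj (g z * cnj (f z)))"
      by (simp add: mult.commute)
    then show "(\<integral>z. f z * cnj (g z) \<partial>circle_measure) = cnj (\<integral>z. g z * cnj (f z) \<partial>circle_measure)"
      by (simp only: Bochner_Integration.integral_cnj)
  qed
  have ci_add: "cinner (x + y) z = cinner x z + cinner y z" for x y z :: L2
    by transfer (auto simp: eq_ae_def ring_distribs integrable_mult_cnj)
  have ci_sc: "cinner (a *\<^sub>C x) y = a * cinner x y" for a and x y :: L2
    by transfer (auto simp: mult.assoc)
  have ci_self: "cinner x x = complex_of_real (inner x x) \<and> 0 \<le> inner x x \<and> (inner x x = 0 \<longrightarrow> x = 0)"
    for x :: L2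
    unfolding inner_L2_def
  proof transfer
    fix f assume "eq_ae f f"
    then have f: "square_integrable f" by (simp add: eq_ae_def)
    then have [measurable]: "f \<in> borel_measurable circle_measure"
      by (simp add: square_integrable_def)
    have eq: "(\<integral>z. f z * cnj (f z) \<partial>circle_measure)
        = complex_of_real (\<integral>z. (cmod (f z))\<^sup>2 \<partial>circle_measure)"
      by (simp only: complex_norm_square[symmetric] integral_complex_of_real)
    have "AE z in circle_measure. f z = 0" if "(\<integral>z. (cmod (f z))\<^sup>2 \<partial>circle_measure) = 0"
      using that f
      by (subst (asm) integral_nonneg_eq_0_iff_AE) (auto simp: square_integrable_def)
    with f show "(\<integral>z. f z * cnj (f z) \<partial>circle_measure) =
        complex_of_real (Re (\<integral>z. f z * cnj (f z) \<partial>circle_measure)) \<and>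
        0 \<le> Re (\<integral>z. f z * cnj (f z) \<partial>circle_measure) \<and>
        (Re (\<integral>z. f z * cnj (f z) \<partial>circle_measure) = 0 \<longrightarrow> eq_ae f (\<lambda>_. 0))"
      unfolding eq by (auto simp: eq_ae_def)
  qed
  fix x y z :: L2 and a b :: complex and r s :: real
  show "x + y + z = x + (y + z)"
    by transfer (auto simp: eq_ae_def add.assoc intro!: square_integrable_add)
  show "x + y = y + x"
    by transfer (auto simp: eq_ae_def add.commute intro!: square_integrable_add)
  show "0 + x = x"
    by transfer (auto simp: eq_ae_def)
  have neg: "(-1) *\<^sub>C x + x = 0" for x :: L2
    using sc_add_l[of "-1" 1 x] by (simp add: sc_1 sc_0)
  show "- x + x = 0"
    by (simp add: uminus_L2_def neg)
  show "x - y = x + - y"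
    by (simp add: minus_L2_def uminus_L2_def)
  show "r *\<^sub>R (x + y) = r *\<^sub>R x + r *\<^sub>R y"
    by (simp add: scaleR_L2_def sc_add_r)
  show "(r + s) *\<^sub>R x = r *\<^sub>R x + s *\<^sub>R x"
    by (simp add: scaleR_L2_def sc_add_l)
  show "r *\<^sub>R s *\<^sub>R x = (r * s) *\<^sub>R x"
    by (simp add: scaleR_L2_def sc_sc)
  show "1 *\<^sub>R x = x"
    by (simp add: scaleR_L2_def sc_1)
  show "inner x y = inner y x"
    using ci_comm[of x y] by (simp add: inner_L2_def)
  show "inner (x + y) z = inner x z + inner y z"
    by (simp add: inner_L2_def ci_add)
  show "inner (r *\<^sub>R x) y = r * inner x y"
    by (simp add: inner_L2_def scaleR_L2_def ci_sc)
  show "0 \<le> inner x x"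
    using ci_self[of x] by simp
  show "inner x x = 0 \<longleftrightarrow> x = 0"
    using ci_self[of x] ci_sc[of 0 0 x] sc_0[of 0] by (auto simp: inner_L2_def)
  show "complex_of_real r *\<^sub>C x = r *\<^sub>R x"
    by (simp add: scaleR_L2_def)
  show "inner x y = Re (cinner x y)"
    by (simp add: inner_L2_def)
  show "a *\<^sub>C (x + y) = a *\<^sub>C x + a *\<^sub>C y" by (fact sc_add_r)
  show "(a + b) *\<^sub>C x = a *\<^sub>C x + b *\<^sub>C x" by (fact sc_add_l)
  show "a *\<^sub>C b *\<^sub>C x = (a * b) *\<^sub>C x" by (fact sc_sc)
  show "cinner x y = cnj (cinner y x)" by (fact ci_comm)
  show "cinner (x + y) z = cinner x z + cinner y z" by (fact ci_add)
  show "cinner (a *\<^sub>C x) y = a * cinner x y" by (fact ci_sc)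
qed (fact norm_L2_def dist_L2_def sgn_L2_def uniformity_L2_def open_L2_def)+

end

section \<open>Multiplication operators and complex conjugation\<close>

text \<open>
  Elements of \<open>L\<^sup>\<infinity>\<close> are given by representatives satisfying \<^const>\<open>ess_bounded\<close>.
  For other functions \<open>mult_op\<close> has the default value \<open>0\<close>.
\<close>

lift_definition mult_op :: "(complex \<Rightarrow> complex) \<Rightarrow> L2 \<Rightarrow> L2"
  is "\<lambda>\<psi> f. if ess_bounded \<psi> then (\<lambda>z. \<psi> z * f z) else (\<lambda>_. 0)"
  by (auto simp: eq_ae_def square_integrable_mult)

lift_definition J_tilde :: "L2 \<Rightarrow> L2" is "\<lambda>f z. cnj (f z)"
  by (auto simp: eq_ae_def square_integrable_cnj)

lemma ess_bounded_id: "ess_bounded (\<lambda>z. z)" and ess_bounded_cnj: "ess_bounded cnj"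
proof -
  have [measurable]: "(\<lambda>z. z) \<in> borel_measurable circle_measure"
    unfolding measurable_cong_sets[OF sets_circle_measure refl]
    by (rule measurable_restrict_space1) simp
  have "AE z in circle_measure. cmod z \<le> 1"
    by (rule AE_I2) simp
  moreover have "cnj \<in> borel_measurable circle_measure"
    by (rule measurable_compose[OF _ borel_measurable_cnj, of "\<lambda>z. z"]) measurable
  ultimately show "ess_bounded (\<lambda>z. z)" "ess_bounded cnj"
    by (auto simp: ess_bounded_def)
qed

definition M_z :: "L2 \<times> L2 \<Rightarrow> L2 \<times> L2" where
  "M_z = map_prod (mult_op (\<lambda>z. z)) (mult_op (\<lambda>z. z))"

definition M_zbar :: "L2 \<times> L2 \<Rightarrow> L2 \<times> L2" where
  "M_zbar = map_prod (mult_op cnj) (mult_op cnj)"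

end

theory Submission
  imports Defs
begin

text \<open>
  Let \<open>J\<close> be pointwise conjugation. If \<open>D\<close> is bounded, antilinear and intertwines multiplication by
  \<open>z\<close> with multiplication by \<open>cnj z\<close>, then \<open>D \<circ> J\<close> is bounded, linear and commutes with
  multiplication by \<open>z\<close>. The main analytic fact is that such an operator \<open>A\<close> is itself a
  multiplication operator, by \<open>\<psi> = A 1\<close>; since \<open>J\<close> is an involution, \<open>D\<close> is then multiplication by
  \<open>\<psi>\<close> after \<open>J\<close>.

  To see this, consider all bounded \<open>\<phi>\<close> such that \<open>A\<close> commutes with multiplication by \<open>\<phi>\<close>. They form
  an algebra that contains \<open>z\<close> and, because multiplication by \<open>cnj z\<close> inverts multiplication by
  \<open>z\<close>, also \<open>cnj z\<close>. By dominated convergence and the continuity of \<open>A\<close> this algebra is closed under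
  bounded pointwise limits. So it contains polynomials in the real and imaginary part of \<open>z\<close>, by
  Stone and Weierstrass the indicators of closed sets, by a Dynkin argument those of Borel sets, and
  finally all bounded measurable functions. Hence \<open>A \<phi> = \<phi> \<psi>\<close> for bounded \<open>\<phi>\<close>. Testing this on the
  indicator of the set where \<open>\<psi>\<close> exceeds the norm bound of \<open>A\<close> shows that \<open>\<psi>\<close> is essentially
  bounded, and cutting off a square-integrable function at height \<open>n\<close> carries the formula over to
  it (lemma \<open>is_mult_op\<close>).

  The equations between the symbols are pure algebra. Multiplication by \<open>\<psi>\<close> after \<open>J\<close> is its own
  antilinear adjoint, so a block operator \<open>C\<close> of this form has twice the same entry off the diagonal
  and is its own adjoint. For such a \<open>C\<close> the isometry law follows from \<open>C \<circ> C = id\<close>, and \<open>C \<circ> C\<close> is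
  pointwise multiplication by the product of the matrix of symbols with its conjugate. This product
  is the identity matrix almost everywhere if and only if the three equations hold
  (lemma \<open>block_involution_iff\<close>).
\<close>

section \<open>Representatives of square-integrable classes\<close>

text \<open>
  A fixed choice of representatives turns identities in \<^typ>\<open>L2\<close> into almost-everywhere identities
  between functions. The algebraic operations agree with the pointwise ones only up to null sets.
\<close>

lemma square_integrable_rep: "square_integrable (rep_L2 x)"
  using Quotient_rep_reflp[OF Quotient_L2, of x] by (simp add: eq_ae_def)

lemma rep_L2_measurable [measurable]: "rep_L2 x \<in> borel_measurable circle_measure"
  using square_integrable_rep[of x] by (simp add: square_integrable_def)

lemma abs_rep_L2: "abs_L2 (rep_L2 x) = x"
  by (rule Quotient_abs_rep[OF Quotient_L2])

lemma abs_L2_eq_iff: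
  assumes "square_integrable f" "square_integrable g"
  shows "abs_L2 f = abs_L2 g \<longleftrightarrow> (AE z in circle_measure. f z = g z)"
  using Quotient_rel[OF Quotient_L2, of f g] assms by (auto simp: eq_ae_def)

lemma L2_eq_iff: "x = y \<longleftrightarrow> (AE z in circle_measure. rep_L2 x z = rep_L2 y z)"
  using abs_L2_eq_iff[of "rep_L2 x" "rep_L2 y"] by (simp add: abs_rep_L2 square_integrable_rep)

lemma rep_abs_L2:
  assumes "square_integrable f"
  shows "AE z in circle_measure. rep_L2 (abs_L2 f) z = f z"
  using abs_L2_eq_iff[of "rep_L2 (abs_L2 f)" f] assms by (simp add: abs_rep_L2 square_integrable_rep)

lemma rep_plus: "AE z in circle_measure. rep_L2 (x + y) z = rep_L2 x z + rep_L2 y z"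
proof -
  have "x + y = abs_L2 (\<lambda>z. rep_L2 x z + rep_L2 y z)"
    using plus_L2.abs_eq[of "rep_L2 x" "rep_L2 y"] square_integrable_rep
    by (simp add: eq_ae_def abs_rep_L2)
  then show ?thesis
    using rep_abs_L2[OF square_integrable_add[OF square_integrable_rep square_integrable_rep]] by simp
qed

lemma rep_zero: "AE z in circle_measure. rep_L2 0 z = 0"
  unfolding zero_L2_def using rep_abs_L2[OF square_integrable_0] by simp

lemma rep_scaleC: "AE z in circle_measure. rep_L2 (a *\<^sub>C x) z = a * rep_L2 x z"
proof -
  have "a *\<^sub>C x = abs_L2 (\<lambda>z. a * rep_L2 x z)"
    using scaleC_L2.abs_eq[of "rep_L2 x" a] square_integrable_rep
    by (simp add: eq_ae_def abs_rep_L2)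
  then show ?thesis
    using rep_abs_L2[OF square_integrable_cmult[OF square_integrable_rep]] by simp
qed

lemma rep_mult_op:
  assumes "ess_bounded \<psi>"
  shows "AE z in circle_measure. rep_L2 (mult_op \<psi> x) z = \<psi> z * rep_L2 x z"
proof -
  have "mult_op \<psi> x = abs_L2 (\<lambda>z. \<psi> z * rep_L2 x z)"
    using mult_op.abs_eq[of "rep_L2 x" \<psi>] square_integrable_rep assms
    by (simp add: eq_ae_def abs_rep_L2)
  then show ?thesis
    using rep_abs_L2[OF square_integrable_mult[OF assms square_integrable_rep]] by simp
qed

lemma rep_J_tilde: "AE z in circle_measure. rep_L2 (J_tilde x) z = cnj (rep_L2 x z)"
proof -
  have "J_tilde x = abs_L2 (\<lambda>z. cnj (rep_L2 x z))"
    using J_tilde.abs_eq[of "rep_L2 x"] square_integrable_rep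
    by (simp add: eq_ae_def abs_rep_L2)
  then show ?thesis
    using rep_abs_L2[OF square_integrable_cnj[OF square_integrable_rep]] by simp
qed

lemma cinner_L2_rep: "cinner x y = (\<integral>z. rep_L2 x z * cnj (rep_L2 y z) \<partial>circle_measure)"
  using cinner_L2.abs_eq[of "rep_L2 x" "rep_L2 y"] square_integrable_rep
  by (simp add: eq_ae_def abs_rep_L2)

lemma norm_L2_rep: "(norm x)\<^sup>2 = (\<integral>z. (cmod (rep_L2 x z))\<^sup>2 \<partial>circle_measure)" for x :: L2
proof -
  have "(norm x)\<^sup>2 = Re (cinner x x)"
    by (simp add: power2_norm_eq_inner inner_eq_Re_cinner)
  also have "cinner x x = complex_of_real (\<integral>z. (cmod (rep_L2 x z))\<^sup>2 \<partial>circle_measure)"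
    by (simp only: cinner_L2_rep complex_norm_square[symmetric] integral_complex_of_real)
  finally show ?thesis by simp
qed

lemma square_integrable_const: "square_integrable (\<lambda>_. c)"
proof -
  have "finite_measure circle_measure"
    by (rule finite_measureI) (simp add: emeasure_circle_measure_space)
  then show ?thesis by (simp add: square_integrable_def finite_measure.integrable_const)
qed

lemma ex_rep_L2_one:
  obtains e where "AE z in circle_measure. rep_L2 e z = 1"
  using rep_abs_L2[OF square_integrable_const] that by blast

section \<open>Multiplication operators and pointwise conjugation\<close>

lemma ess_bounded_measurable: "ess_bounded \<psi> \<Longrightarrow> \<psi> \<in> borel_measurable circle_measure"
  by (simp add: ess_bounded_def)

lemma ess_boundedI:
  assumes "\<psi> \<in> borel_measurable circle_measure" "\<And>z. z \<in> sphere 0 1 \<Longrightarrow> cmod (\<psi> z) \<le> K"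
  shows "ess_bounded \<psi>"
  using assms unfolding ess_bounded_def by (auto intro!: exI[of _ K] AE_I2)

lemma ess_bounded_add:
  assumes "ess_bounded \<phi>" "ess_bounded \<psi>"
  shows "ess_bounded (\<lambda>z. \<phi> z + \<psi> z)"
proof -
  obtain K L where "AE z in circle_measure. cmod (\<phi> z) \<le> K" "AE z in circle_measure. cmod (\<psi> z) \<le> L"
    using assms unfolding ess_bounded_def by blast
  then have "AE z in circle_measure. cmod (\<phi> z + \<psi> z) \<le> K + L"
    by eventually_elim (meson norm_triangle_mono)
  then show ?thesis using assms unfolding ess_bounded_def by auto
qed

lemma ess_bounded_mult:
  assumes "ess_bounded \<phi>" "ess_bounded \<psi>"
  shows "ess_bounded (\<lambda>z. \<phi> z * \<psi> z)"
proof -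
  obtain K L where "AE z in circle_measure. cmod (\<phi> z) \<le> K" "AE z in circle_measure. cmod (\<psi> z) \<le> L"
    using assms unfolding ess_bounded_def by blast
  then have "AE z in circle_measure. cmod (\<phi> z * \<psi> z) \<le> \<bar>K\<bar> * \<bar>L\<bar>"
    by eventually_elim (auto simp: norm_mult intro!: mult_mono)
  then show ?thesis using assms unfolding ess_bounded_def by auto
qed

lemma mult_op_cong_AE:
  assumes "ess_bounded \<phi>" "ess_bounded \<psi>" "AE z in circle_measure. \<phi> z = \<psi> z"
  shows "mult_op \<phi> x = mult_op \<psi> x"
  unfolding L2_eq_iff
  using rep_mult_op[OF assms(1), of x] rep_mult_op[OF assms(2), of x] assms(3)
  by eventually_elim simp

lemma mult_op_add_left:
  assumes "ess_bounded \<phi>" "ess_bounded \<psi>"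
  shows "mult_op (\<lambda>z. \<phi> z + \<psi> z) x = mult_op \<phi> x + mult_op \<psi> x"
  unfolding L2_eq_iff
  using rep_mult_op[OF assms(1), of x] rep_mult_op[OF assms(2), of x]
    rep_mult_op[OF ess_bounded_add[OF assms], of x] rep_plus[of "mult_op \<phi> x" "mult_op \<psi> x"]
  by eventually_elim (simp add: ring_distribs)

lemma mult_op_add_right:
  assumes "ess_bounded \<phi>"
  shows "mult_op \<phi> (x + y) = mult_op \<phi> x + mult_op \<phi> y"
  unfolding L2_eq_iff
  using rep_mult_op[OF assms, of x] rep_mult_op[OF assms, of y] rep_mult_op[OF assms, of "x + y"]
    rep_plus[of x y] rep_plus[of "mult_op \<phi> x" "mult_op \<phi> y"]
  by eventually_elim (simp add: ring_distribs)

lemma mult_op_mult: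
  assumes "ess_bounded \<phi>" "ess_bounded \<psi>"
  shows "mult_op (\<lambda>z. \<phi> z * \<psi> z) x = mult_op \<phi> (mult_op \<psi> x)"
  unfolding L2_eq_iff
  using rep_mult_op[OF assms(1), of "mult_op \<psi> x"] rep_mult_op[OF assms(2), of x]
    rep_mult_op[OF ess_bounded_mult[OF assms], of x]
  by eventually_elim simp

lemma mult_op_const: "mult_op (\<lambda>_. c) x = c *\<^sub>C x"
  unfolding L2_eq_iff using rep_mult_op[OF ess_bounded_const, of c x] rep_scaleC[of c x]
  by eventually_elim simp

lemma mult_op_zbar_z: "mult_op cnj (mult_op (\<lambda>z. z) x) = x"
proof -
  have "AE z in circle_measure. cmod z = 1" by (rule AE_I2) simp
  then show ?thesis
    unfolding L2_eq_iff
    using rep_mult_op[OF ess_bounded_cnj, of "mult_op (\<lambda>z. z) x"] rep_mult_op[OF ess_bounded_id, of x]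
    by eventually_elim (simp add: mult.assoc[symmetric] complex_norm_square[symmetric] mult.commute[of "cnj _"])
qed

lemma mult_op_z_zbar: "mult_op (\<lambda>z. z) (mult_op cnj x) = x"
  using mult_op_mult[OF ess_bounded_cnj ess_bounded_id, of x]
    mult_op_mult[OF ess_bounded_id ess_bounded_cnj, of x] mult_op_zbar_z[of x]
  by (simp add: mult.commute)

lemma J_tilde_J_tilde: "J_tilde (J_tilde x) = x"
  unfolding L2_eq_iff using rep_J_tilde[of "J_tilde x"] rep_J_tilde[of x] by eventually_elim simp

lemma J_tilde_mult_op_z: "J_tilde (mult_op (\<lambda>z. z) x) = mult_op cnj (J_tilde x)"
  unfolding L2_eq_iff
  using rep_J_tilde[of "mult_op (\<lambda>z. z) x"] rep_mult_op[OF ess_bounded_id, of x]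
    rep_mult_op[OF ess_bounded_cnj, of "J_tilde x"] rep_J_tilde[of x]
  by eventually_elim simp

lemma J_tilde_mult_op_zbar: "J_tilde (mult_op cnj x) = mult_op (\<lambda>z. z) (J_tilde x)"
  using J_tilde_mult_op_z[of "J_tilde x"] J_tilde_J_tilde by metis

lemma antilinear_J_tilde: "antilinear J_tilde"
proof -
  have "J_tilde (x + y) = J_tilde x + J_tilde y" for x y
    unfolding L2_eq_iff
    using rep_J_tilde[of x] rep_J_tilde[of y] rep_J_tilde[of "x + y"] rep_plus[of x y]
      rep_plus[of "J_tilde x" "J_tilde y"]
    by eventually_elim simp
  moreover have "J_tilde (a *\<^sub>C x) = cnj a *\<^sub>C J_tilde x" for a x
    unfolding L2_eq_iff
    using rep_J_tilde[of x] rep_J_tilde[of "a *\<^sub>C x"] rep_scaleC[of a x] rep_scaleC[of "cnj a" "J_tilde x"]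
    by eventually_elim simp
  ultimately show ?thesis by (simp add: antilinear_def)
qed

lemma norm_J_tilde: "norm (J_tilde x) = norm x"
proof -
  have "(norm (J_tilde x))\<^sup>2 = (norm x)\<^sup>2"
    unfolding norm_L2_rep
    by (rule integral_cong_AE) (use rep_J_tilde[of x] in auto)
  then show ?thesis by simp
qed

lemma antilinear_mult_op_J_tilde:
  assumes "ess_bounded \<psi>"
  shows "antilinear (mult_op \<psi> \<circ> J_tilde)"
proof -
  have "mult_op \<psi> (a *\<^sub>C x) = a *\<^sub>C mult_op \<psi> x" for a x
    using mult_op_mult[OF assms ess_bounded_const, of a x] mult_op_mult[OF ess_bounded_const assms, of a x]
    by (simp add: mult_op_const mult.commute)
  then show ?thesis
    using antilinear_J_tilde assms by (simp add: antilinear_def mult_op_add_right)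
qed

text \<open>
  Both sides of the adjoint identity are the integral of \<open>\<psi> * cnj f * cnj g\<close>, which is symmetric in
  \<open>f\<close> and \<open>g\<close>.
\<close>

lemma antilinear_adjoint_mult_op_J_tilde:
  assumes "ess_bounded \<psi>"
  shows "is_antilinear_adjoint (mult_op \<psi> \<circ> J_tilde) (mult_op \<psi> \<circ> J_tilde)"
proof -
  have rep: "AE z in circle_measure. rep_L2 ((mult_op \<psi> \<circ> J_tilde) x) z = \<psi> z * cnj (rep_L2 x z)" for x
    using rep_mult_op[OF assms, of "J_tilde x"] rep_J_tilde[of x] by eventually_elim simp
  note [measurable] = ess_bounded_measurable[OF assms]
  have "cinner ((mult_op \<psi> \<circ> J_tilde) f) g = cnj (cinner f ((mult_op \<psi> \<circ> J_tilde) g))" for f g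
    unfolding cinner_L2_rep Bochner_Integration.integral_cnj[symmetric]
    by (rule integral_cong_AE) (use rep[of f] rep[of g] in \<open>auto elim!: eventually_elim2\<close>)
  then show ?thesis
    using antilinear_mult_op_J_tilde[OF assms] by (simp add: is_antilinear_adjoint_def)
qed

section \<open>Bounded operators commuting with the shift\<close>

text \<open>
  This is dominated convergence for the squared norm, with majorant \<open>K\<^sup>2 * (cmod x)\<^sup>2\<close>.
\<close>

lemma tendsto_mult_op_0:
  assumes "\<And>n. \<phi> n \<in> borel_measurable circle_measure"
    and "\<And>n z. z \<in> sphere 0 1 \<Longrightarrow> cmod (\<phi> n z) \<le> K"
    and "\<And>z. z \<in> sphere 0 1 \<Longrightarrow> (\<lambda>n. \<phi> n z) \<longlonglongrightarrow> 0"
  shows "(\<lambda>n. mult_op (\<phi> n) x) \<longlonglongrightarrow> 0"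
proof -
  have eb: "ess_bounded (\<phi> n)" for n by (rule ess_boundedI) (use assms in auto)
  note [measurable] = assms(1)
  have sq: "(norm (mult_op (\<phi> n) x))\<^sup>2 = (\<integral>z. (cmod (\<phi> n z * rep_L2 x z))\<^sup>2 \<partial>circle_measure)" for n
    unfolding norm_L2_rep by (rule integral_cong_AE) (use rep_mult_op[OF eb[of n], of x] in auto)
  have "(\<lambda>n. \<integral>z. (cmod (\<phi> n z * rep_L2 x z))\<^sup>2 \<partial>circle_measure) \<longlonglongrightarrow> (\<integral>z. 0 \<partial>circle_measure)"
  proof (rule integral_dominated_convergence)
    show "integrable circle_measure (\<lambda>z. K\<^sup>2 * (cmod (rep_L2 x z))\<^sup>2)"
      using square_integrable_rep[of x] by (simp add: square_integrable_def)
    show "AE z in circle_measure. (\<lambda>n. (cmod (\<phi> n z * rep_L2 x z))\<^sup>2) \<longlonglongrightarrow> 0"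
    proof (rule AE_I2)
      fix z assume "z \<in> space circle_measure"
      then have "(\<lambda>n. \<phi> n z) \<longlonglongrightarrow> 0" using assms(3) by simp
      from tendsto_power[OF tendsto_norm[OF tendsto_mult[OF this tendsto_const]], of "rep_L2 x z" 2]
      show "(\<lambda>n. (cmod (\<phi> n z * rep_L2 x z))\<^sup>2) \<longlonglongrightarrow> 0" by simp
    qed
    show "AE z in circle_measure. norm ((cmod (\<phi> n z * rep_L2 x z))\<^sup>2) \<le> K\<^sup>2 * (cmod (rep_L2 x z))\<^sup>2" for n
      using assms(2)
      by (intro AE_I2) (auto simp: norm_mult power_mult_distrib intro!: mult_right_mono power_mono)
  qed (auto)
  then have "(\<lambda>n. (norm (mult_op (\<phi> n) x))\<^sup>2) \<longlonglongrightarrow> 0" by (simp add: sq)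
  then have "(\<lambda>n. sqrt ((norm (mult_op (\<phi> n) x))\<^sup>2)) \<longlonglongrightarrow> sqrt 0" by (rule tendsto_real_sqrt)
  then show ?thesis by (simp add: tendsto_norm_zero_iff)
qed

lemma tendsto_mult_op:
  assumes "\<And>n. \<phi> n \<in> borel_measurable circle_measure" "\<psi> \<in> borel_measurable circle_measure"
    and "\<And>n z. z \<in> sphere 0 1 \<Longrightarrow> cmod (\<phi> n z) \<le> K"
    and "\<And>z. z \<in> sphere 0 1 \<Longrightarrow> (\<lambda>n. \<phi> n z) \<longlonglongrightarrow> \<psi> z"
  shows "(\<lambda>n. mult_op (\<phi> n) x) \<longlonglongrightarrow> mult_op \<psi> x" and "ess_bounded \<psi>"
proof -
  have \<psi>: "cmod (\<psi> z) \<le> K" if "z \<in> sphere 0 1" for z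
    using LIMSEQ_le_const2[OF tendsto_norm[OF assms(4)[OF that]]] assms(3)[OF that] by auto
  have eb: "ess_bounded (\<phi> n)" for n by (rule ess_boundedI) (use assms in auto)
  show eb': "ess_bounded \<psi>" by (rule ess_boundedI) (use assms \<psi> in auto)
  note [measurable] = assms(1,2)
  have "(\<lambda>n. mult_op (\<lambda>z. \<phi> n z - \<psi> z) x) \<longlonglongrightarrow> 0"
  proof (rule tendsto_mult_op_0)
    show "cmod (\<phi> n z - \<psi> z) \<le> K + K" if "z \<in> sphere 0 1" for n z
      using norm_triangle_ineq4[of "\<phi> n z" "\<psi> z"] assms(3)[OF that, of n] \<psi>[OF that] by linarith
    show "(\<lambda>n. \<phi> n z - \<psi> z) \<longlonglongrightarrow> 0" if "z \<in> sphere 0 1" for z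
      using assms(4)[OF that] by (simp add: LIM_zero)
  qed auto
  moreover have "mult_op (\<lambda>z. \<phi> n z - \<psi> z) x + mult_op \<psi> x = mult_op (\<phi> n) x" for n
  proof -
    have "ess_bounded (\<lambda>z. \<phi> n z - \<psi> z)"
      using ess_bounded_add[OF eb[of n] ess_bounded_mult[OF ess_bounded_const[of "-1"] eb']] by simp
    from mult_op_add_left[OF this eb', of x] show ?thesis by simp
  qed
  ultimately show "(\<lambda>n. mult_op (\<phi> n) x) \<longlonglongrightarrow> mult_op \<psi> x"
    using tendsto_add[OF _ tendsto_const, of "\<lambda>n. mult_op (\<lambda>z. \<phi> n z - \<psi> z) x" 0 sequentially "mult_op \<psi> x"]
    by simp
qed

lemma borel_measurable_circle_measure:
  "f \<in> borel_measurable borel \<Longrightarrow> f \<in> borel_measurable circle_measure"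
  unfolding measurable_cong_sets[OF sets_circle_measure refl] by (rule measurable_restrict_space1)

definition commutes_with_mult :: "(L2 \<Rightarrow> L2) \<Rightarrow> (complex \<Rightarrow> complex) \<Rightarrow> bool" where
  "commutes_with_mult A \<psi> \<longleftrightarrow> ess_bounded \<psi> \<and> (\<forall>x. A (mult_op \<psi> x) = mult_op \<psi> (A x))"

locale shift_commuting =
  fixes A :: "L2 \<Rightarrow> L2"
  assumes bounded_linear: "bounded_linear A"
    and scaleC: "A (c *\<^sub>C x) = c *\<^sub>C A x"
    and shift: "A (mult_op (\<lambda>z. z) x) = mult_op (\<lambda>z. z) (A x)"
begin

sublocale bounded_linear A by (rule bounded_linear)

text \<open>
  Both sides of the commutation identity converge in \<^typ>\<open>L2\<close>, one of them by the continuity of \<open>A\<close>.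
  All limit passages below take place among the multipliers, through this lemma.
\<close>

lemma commutes_bounded_limit:
  assumes "\<And>n. commutes_with_mult A (\<phi> n)" "\<psi> \<in> borel_measurable circle_measure"
    and "\<And>n z. z \<in> sphere 0 1 \<Longrightarrow> cmod (\<phi> n z) \<le> K"
    and "\<And>z. z \<in> sphere 0 1 \<Longrightarrow> (\<lambda>n. \<phi> n z) \<longlonglongrightarrow> \<psi> z"
  shows "commutes_with_mult A \<psi>"
proof -
  have m: "\<phi> n \<in> borel_measurable circle_measure" for n
    using assms(1)[of n] by (simp add: commutes_with_mult_def ess_bounded_def)
  note lim = tendsto_mult_op[OF m assms(2-4)]
  have "A (mult_op \<psi> x) = mult_op \<psi> (A x)" for x
  proof (rule LIMSEQ_unique)
    show "(\<lambda>n. A (mult_op (\<phi> n) x)) \<longlonglongrightarrow> A (mult_op \<psi> x)"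
      by (rule tendsto[OF lim(1)])
    show "(\<lambda>n. A (mult_op (\<phi> n) x)) \<longlonglongrightarrow> mult_op \<psi> (A x)"
      using lim(1)[of "A x"] assms(1) by (simp add: commutes_with_mult_def)
  qed
  then show ?thesis using lim(2) by (simp add: commutes_with_mult_def)
qed

lemma commutes_const: "commutes_with_mult A (\<lambda>_. c)"
  by (simp add: commutes_with_mult_def mult_op_const scaleC)

lemma commutes_add:
  assumes "commutes_with_mult A \<phi>" "commutes_with_mult A \<psi>"
  shows "commutes_with_mult A (\<lambda>z. \<phi> z + \<psi> z)"
  using assms by (simp add: commutes_with_mult_def ess_bounded_add mult_op_add_left add)

lemma commutes_mult:
  assumes "commutes_with_mult A \<phi>" "commutes_with_mult A \<psi>"
  shows "commutes_with_mult A (\<lambda>z. \<phi> z * \<psi> z)"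
  using assms by (simp add: commutes_with_mult_def ess_bounded_mult mult_op_mult)

lemma commutes_sum:
  assumes "finite I" "\<And>i. i \<in> I \<Longrightarrow> commutes_with_mult A (\<phi> i)"
  shows "commutes_with_mult A (\<lambda>z. \<Sum>i\<in>I. \<phi> i z)"
  using assms by (induction I rule: finite_induct) (auto intro: commutes_const commutes_add)

lemma commutes_z: "commutes_with_mult A (\<lambda>z. z)"
  by (simp add: commutes_with_mult_def ess_bounded_id shift)

text \<open>
  On the circle multiplication by \<^const>\<open>cnj\<close> is the inverse of multiplication by \<open>z\<close>, and an operator
  that commutes with an invertible one commutes with the inverse.
\<close>

lemma commutes_zbar: "commutes_with_mult A cnj"
proof -
  have "A (mult_op cnj x) = mult_op cnj (A x)" for x
    using arg_cong[OF shift[of "mult_op cnj x"], of "mult_op cnj"]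
    by (simp add: mult_op_zbar_z mult_op_z_zbar)
  then show ?thesis by (simp add: commutes_with_mult_def ess_bounded_cnj)
qed

lemma commutes_polynomial:
  assumes "real_polynomial_function p"
  shows "commutes_with_mult A (\<lambda>z. complex_of_real (p z))"
  using assms
proof (induction p rule: real_polynomial_function.induct)
  case (linear h)
  then interpret h: bounded_linear h .
  \<comment> \<open>a real-linear functional on the plane is a complex combination of \<open>z\<close> and \<open>cnj z\<close>\<close>
  have eq: "complex_of_real (h z)
      = (complex_of_real (h 1) - \<i> * complex_of_real (h \<i>)) / 2 * z
        + (complex_of_real (h 1) + \<i> * complex_of_real (h \<i>)) / 2 * cnj z" for z
  proof -
    have "z = Re z *\<^sub>R 1 + Im z *\<^sub>R \<i>"
      by (simp add: complex_eq_iff)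
    then have "h z = h (Re z *\<^sub>R 1 + Im z *\<^sub>R \<i>)"
      by (rule arg_cong)
    also have "\<dots> = Re z * h 1 + Im z * h \<i>"
      by (simp only: h.add h.scaleR real_scaleR_def)
    finally show ?thesis
      by (simp add: complex_eq_iff algebra_simps add_divide_distrib diff_divide_distrib)
  qed
  show ?case
    unfolding ext[of "\<lambda>z. complex_of_real (h z)", OF eq]
    by (intro commutes_add commutes_mult commutes_const commutes_z commutes_zbar)
qed (auto intro: commutes_const commutes_add commutes_mult)

text \<open>
  The indicator of a nonempty closed set is the limit of the continuous functions \<open>max 0 (1 - n * d)\<close>, where
  \<open>d\<close> is the distance from the set. Replacing the \<open>n\<close>-th one by a polynomial within \<open>1 / (n + 1)\<close>
  changes neither the limit nor boundedness.
\<close>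

lemma commutes_indicator_closed:
  assumes "closed F"
  shows "commutes_with_mult A (\<lambda>z. indicator F z)"
proof -
  define f :: "nat \<Rightarrow> complex \<Rightarrow> real" where "f n z = max 0 (1 - real n * infdist z F)" for n z
  have cont: "continuous_on (sphere 0 1) (f n)" for n
    unfolding f_def by (intro continuous_intros)
  have "\<exists>p. real_polynomial_function p \<and> (\<forall>z\<in>sphere 0 1. \<bar>f n z - p z\<bar> < inverse (Suc n))" for n
    by (rule Stone_Weierstrass_real_polynomial_function[of "sphere 0 1" "f n" "inverse (Suc n)"])
      (use cont in \<open>auto simp del: of_nat_Suc\<close>)
  then obtain p where p: "\<And>n. real_polynomial_function (p n)"
    "\<And>n z. z \<in> sphere 0 1 \<Longrightarrow> \<bar>f n z - p n z\<bar> < inverse (Suc n)" by metis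
  \<comment> \<open>\<^const>\<open>infdist\<close> to the empty set is \<open>0\<close>, so the approximation fails there\<close>
  show ?thesis
  proof (cases "F = {}")
    case True then show ?thesis using commutes_const[of 0] by simp
  next
    case False
    show ?thesis
    proof (rule commutes_bounded_limit)
      show "commutes_with_mult A (\<lambda>z. complex_of_real (p n z))" for n
        by (rule commutes_polynomial[OF p(1)])
      show "(\<lambda>z. indicator F z :: complex) \<in> borel_measurable circle_measure"
        using assms by (intro borel_measurable_circle_measure) auto
      show "cmod (complex_of_real (p n z)) \<le> 2" if "z \<in> sphere 0 1" for n z
      proof -
        have "inverse (real (Suc n)) \<le> 1" by (simp add: field_simps)
        moreover have "0 \<le> f n z" "f n z \<le> 1" by (auto simp: f_def infdist_nonneg)
        ultimately show ?thesis using p(2)[OF that, of n] by auto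
      qed
      show "(\<lambda>n. complex_of_real (p n z)) \<longlonglongrightarrow> indicator F z" if "z \<in> sphere 0 1" for z
      proof -
        have "(\<lambda>n. f n z) \<longlonglongrightarrow> indicator F z"
        proof (cases "z \<in> F")
          case True then show ?thesis by (simp add: f_def)
        next
          case zF: False
          then have pos: "infdist z F > 0"
            using in_closed_iff_infdist_zero[OF assms False] infdist_nonneg[of z F] by force
          have "f n z = 0" if "real n > 1 / infdist z F" for n
            using that pos by (simp add: f_def field_simps)
          then have "eventually (\<lambda>n. f n z = 0) sequentially"
            using reals_Archimedean2[of "1 / infdist z F"]
            by (metis (mono_tags, lifting) eventually_sequentiallyI of_nat_le_iff order_less_le_trans)
          then show ?thesis using zF by (simp add: tendsto_eventually)
        qed
        moreover have "(\<lambda>n. f n z - p n z) \<longlonglongrightarrow> 0"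
          by (rule tendsto_rabs_zero_cancel, rule tendsto_sandwich[OF _ _ tendsto_const LIMSEQ_inverse_real_of_nat])
             (use p(2)[OF that] in \<open>auto intro!: always_eventually less_imp_le\<close>)
        ultimately have "(\<lambda>n. f n z - (f n z - p n z)) \<longlonglongrightarrow> indicator F z - 0"
          by (rule tendsto_diff)
        then have "(\<lambda>n. p n z) \<longlonglongrightarrow> indicator F z" by simp
        then have "(\<lambda>n. complex_of_real (p n z)) \<longlonglongrightarrow> complex_of_real (indicator F z)"
          by (rule tendsto_of_real)
        then show ?thesis by (cases "z \<in> F") simp_all
      qed
    qed
  qed
qed

text \<open>
  The Borel sets whose indicator commutes form a Dynkin system: complements by subtraction from
  \<open>1\<close>, disjoint unions as bounded limits of the partial sums. It contains the intersection-stable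
  generator consisting of the closed sets.
\<close>

lemma commutes_indicator_borel:
  assumes "E \<in> sets borel"
  shows "commutes_with_mult A (\<lambda>z. indicator E z)"
proof -
  have "Int_stable (Collect closed :: complex set set)"
    by (auto simp: Int_stable_def)
  moreover have "Collect closed \<subseteq> Pow (UNIV :: complex set)"
    by simp
  moreover have "E \<in> sigma_sets UNIV (Collect closed)"
    using assms by (simp add: borel_eq_closed)
  ultimately show ?thesis
  proof (induction E rule: sigma_sets_induct_disjoint)
    case (basic E)
    then show ?case by (simp add: commutes_indicator_closed)
  next
    case empty
    then show ?case using commutes_const[of 0] by simp
  next
    case (compl E)
    have "(\<lambda>z. indicator (UNIV - E) z :: complex) = (\<lambda>z. 1 + (-1) * indicator E z)"
      by (auto simp: indicator_def)
    then show ?case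
      by (simp only:) (intro commutes_add commutes_mult commutes_const compl)
  next
    case (union E)
    show ?case
    proof (rule commutes_bounded_limit)
      show "commutes_with_mult A (\<lambda>z. \<Sum>i<n. indicator (E i) z)" for n
        by (intro commutes_sum union) auto
      have "(\<Union>i. E i) \<in> sets borel"
        using union by (intro sets.countable_UN) (auto simp: borel_eq_closed)
      then show "(\<lambda>z. indicator (\<Union>i. E i) z :: complex) \<in> borel_measurable circle_measure"
        by (intro borel_measurable_circle_measure) auto
      have eq: "(\<Sum>i<n. indicator (E i) z) = (indicator (\<Union>i<n. E i) z :: complex)" for n z
        using union(1)
        by (subst indicator_UN_disjoint) (auto simp: disjoint_family_on_def)
      show "cmod (\<Sum>i<n. indicator (E i) z) \<le> 1" for n z
        unfolding eq by (simp add: indicator_def)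
      show "(\<lambda>n. \<Sum>i<n. indicator (E i) z) \<longlonglongrightarrow> (indicator (\<Union>i. E i) z :: complex)" for z
        unfolding eq by (rule LIMSEQ_indicator_UN)
    qed
  qed
qed

lemma commutes_simple:
  assumes "simple_function circle_measure s"
  shows "commutes_with_mult A s"
proof -
  let ?L = "\<lambda>y. s -` {y} \<inter> sphere 0 1"
  have fin: "finite (s ` sphere 0 1)"
    using simple_functionD(1)[OF assms] by simp
  have lev: "?L y \<in> sets borel" for y
    using simple_functionD(2)[OF assms, of "{y}"] by (simp add: sets_circle_measure sets_restrict_space_iff)
  have comm: "commutes_with_mult A (\<lambda>z. \<Sum>y\<in>s ` sphere 0 1. y * indicator (?L y) z)"
    by (intro commutes_sum commutes_mult commutes_const commutes_indicator_borel fin lev)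
  have eq: "(\<Sum>y\<in>s ` sphere 0 1. y * indicator (?L y) z) = s z" if "z \<in> sphere 0 1" for z
  proof -
    have "(\<Sum>y\<in>s ` sphere 0 1. y * indicator (?L y) z) = (\<Sum>y\<in>s ` sphere 0 1. if y = s z then y else 0)"
      using that by (intro sum.cong) (auto simp: indicator_def)
    then show ?thesis using fin that by simp
  qed
  have "ess_bounded s"
  proof (rule ess_boundedI)
    show "s \<in> borel_measurable circle_measure"
      using assms by (rule borel_measurable_simple_function)
    show "cmod (s z) \<le> Max (cmod ` s ` sphere 0 1)" if "z \<in> sphere 0 1" for z
      using fin that by (intro Max_ge) auto
  qed
  moreover have "AE z in circle_measure. (\<Sum>y\<in>s ` sphere 0 1. y * indicator (?L y) z) = s z"
    using eq by (intro AE_I2) auto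
  ultimately have "mult_op (\<lambda>z. \<Sum>y\<in>s ` sphere 0 1. y * indicator (?L y) z) x = mult_op s x" for x
    using comm by (intro mult_op_cong_AE) (simp_all add: commutes_with_mult_def)
  then show ?thesis
    using comm \<open>ess_bounded s\<close> by (simp add: commutes_with_mult_def)
qed

lemma commutes_bounded:
  assumes "\<phi> \<in> borel_measurable circle_measure" "\<And>z. z \<in> sphere 0 1 \<Longrightarrow> cmod (\<phi> z) \<le> K"
  shows "commutes_with_mult A \<phi>"
proof -
  obtain s where s: "\<And>i. simple_function circle_measure (s i)"
    "\<And>z. z \<in> sphere 0 1 \<Longrightarrow> (\<lambda>i. s i z) \<longlonglongrightarrow> \<phi> z"
    "\<And>i z. z \<in> sphere 0 1 \<Longrightarrow> dist (s i z) 0 \<le> 2 * dist (\<phi> z) 0"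
    using borel_measurable_implies_sequence_metric[OF assms(1), of 0, unfolded space_circle_measure]
    by metis
  show ?thesis
  proof (rule commutes_bounded_limit[OF commutes_simple[OF s(1)] assms(1)])
    show "cmod (s i z) \<le> 2 * K" if "z \<in> sphere 0 1" for i z
      using s(3)[OF that, of i] assms(2)[OF that] by simp
  qed (use s(2) in auto)
qed

text \<open>
  The symbol is \<open>\<psi> = A 1\<close>, with \<open>1\<close> represented by \<open>e\<close>. The identity \<open>A \<phi> = \<phi> \<psi>\<close> for bounded \<open>\<phi>\<close> is used
  twice: for the indicator of the set where \<open>\<psi>\<close> is large, to bound \<open>\<psi>\<close>, and for truncations of an
  arbitrary \<open>x\<close>, to identify \<open>A x\<close>.
\<close>

lemma is_mult_op:
  obtains \<psi> where "ess_bounded \<psi>" "A = mult_op \<psi>"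
proof -
  obtain e where rep_e: "AE z in circle_measure. rep_L2 e z = 1"
    by (rule ex_rep_L2_one)
  define \<psi> where "\<psi> = rep_L2 (A e)"
  have [measurable]: "\<psi> \<in> borel_measurable circle_measure"
    by (simp add: \<psi>_def)
  have A_bdd: "AE z in circle_measure. rep_L2 (A (mult_op \<phi> e)) z = \<phi> z * \<psi> z"
    if "\<phi> \<in> borel_measurable circle_measure" "\<And>z. z \<in> sphere 0 1 \<Longrightarrow> cmod (\<phi> z) \<le> K" for \<phi> K
    using commutes_bounded[OF that] rep_mult_op[of \<phi> "A e"]
    by (simp add: commutes_with_mult_def \<psi>_def)
  obtain K where K: "0 \<le> K" "\<And>x. norm (A x) \<le> norm x * K"
    using nonneg_bounded by blast
  have bound: "AE z in circle_measure. cmod (\<psi> z) \<le> K"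
  proof -
    define \<phi> :: "complex \<Rightarrow> complex" where "\<phi> z = (if K < cmod (\<psi> z) then 1 else 0)" for z
    have \<phi>m [measurable]: "\<phi> \<in> borel_measurable circle_measure"
      unfolding \<phi>_def by measurable
    have \<phi>1: "cmod (\<phi> z) \<le> 1" for z by (simp add: \<phi>_def)
    then have eb: "ess_bounded \<phi>" by (intro ess_boundedI) auto
    have n1: "(norm (mult_op \<phi> e))\<^sup>2 = (\<integral>z. (cmod (\<phi> z))\<^sup>2 \<partial>circle_measure)"
      unfolding norm_L2_rep
      by (rule integral_cong_AE) (use rep_mult_op[OF eb, of e] rep_e in \<open>auto elim!: eventually_elim2\<close>)
    have n2: "(norm (A (mult_op \<phi> e)))\<^sup>2 = (\<integral>z. (cmod (\<phi> z * \<psi> z))\<^sup>2 \<partial>circle_measure)"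
      unfolding norm_L2_rep
      by (rule integral_cong_AE) (use A_bdd[OF \<phi>m \<phi>1] in auto)
    have i1: "integrable circle_measure (\<lambda>z. (cmod (\<phi> z))\<^sup>2)"
      using square_integrable_mult[OF eb square_integrable_const[of 1]]
      by (simp add: square_integrable_def)
    have i2: "integrable circle_measure (\<lambda>z. (cmod (\<phi> z * \<psi> z))\<^sup>2)"
      using square_integrable_mult[OF eb square_integrable_rep[of "A e"]]
      by (simp add: square_integrable_def \<psi>_def)
    \<comment> \<open>the integrand is nonnegative, positive where \<open>K < cmod (\<psi> z)\<close>, and has integral at most \<open>0\<close>\<close>
    let ?g = "\<lambda>z. (cmod (\<phi> z * \<psi> z))\<^sup>2 - K\<^sup>2 * (cmod (\<phi> z))\<^sup>2"
    have g0: "0 \<le> ?g z" for z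
      using K(1) by (simp add: \<phi>_def power_mono)
    have gi: "integrable circle_measure ?g"
      using i1 i2 by simp
    have "(norm (A (mult_op \<phi> e)))\<^sup>2 \<le> (norm (mult_op \<phi> e) * K)\<^sup>2"
      by (rule power_mono[OF K(2)]) simp
    then have "(\<integral>z. ?g z \<partial>circle_measure) \<le> 0"
      using i1 i2 by (simp add: n1 n2 power_mult_distrib mult.commute)
    then have "(\<integral>z. ?g z \<partial>circle_measure) = 0"
      by (rule antisym[OF _ Bochner_Integration.integral_nonneg]) (rule g0)
    then have "AE z in circle_measure. ?g z = 0"
      by (rule integral_nonneg_eq_0_iff_AE[OF gi AE_I2[OF g0], THEN iffD1])
    then show ?thesis
    proof eventually_elim
      case (elim z)
      show ?case
      proof (rule ccontr)
        assume "\<not> ?case"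
        then have "K\<^sup>2 < (cmod (\<psi> z))\<^sup>2" using K(1) by (intro power_strict_mono) auto
        then show False using elim \<open>\<not> ?case\<close> by (simp add: \<phi>_def)
      qed
    qed
  qed
  then have eb: "ess_bounded \<psi>" by (auto simp: ess_bounded_def)
  have "A x = mult_op \<psi> x" for x
  proof -
    \<comment> \<open>\<open>cut n * x\<close> is bounded by \<open>n\<close>, so it can play the role of \<open>\<phi>\<close>, while \<open>A\<close> commutes with \<open>cut n\<close>\<close>
    define cut :: "nat \<Rightarrow> complex \<Rightarrow> complex"
      where "cut n z = (if cmod (rep_L2 x z) \<le> real n then 1 else 0)" for n z
    have cut_measurable [measurable]: "cut n \<in> borel_measurable circle_measure" for n
      unfolding cut_def by measurable
    have cut_le_1: "cmod (cut n z) \<le> 1" for n z by (simp add: cut_def)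
    have fm: "(\<lambda>z. cut n z * rep_L2 x z) \<in> borel_measurable circle_measure" for n by measurable
    have f1: "cmod (cut n z * rep_L2 x z) \<le> real n" for n z by (simp add: cut_def)
    have "AE z in circle_measure. cut n z * rep_L2 (A x) z = cut n z * rep_L2 x z * \<psi> z" for n
    proof -
      have c: "commutes_with_mult A (cut n)" by (rule commutes_bounded[OF cut_measurable cut_le_1])
      then have cut_bounded: "ess_bounded (cut n)" by (simp add: commutes_with_mult_def)
      have fb: "ess_bounded (\<lambda>z. cut n z * rep_L2 x z)" by (rule ess_boundedI[OF fm f1])
      have "mult_op (\<lambda>z. cut n z * rep_L2 x z) e = mult_op (cut n) x"
        unfolding L2_eq_iff using rep_mult_op[OF fb, of e] rep_mult_op[OF cut_bounded, of x] rep_e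
        by eventually_elim simp
      then have "A (mult_op (\<lambda>z. cut n z * rep_L2 x z) e) = mult_op (cut n) (A x)"
        using c by (simp add: commutes_with_mult_def)
      with A_bdd[OF fm f1, of n] rep_mult_op[OF cut_bounded, of "A x"] show ?thesis
        by (auto elim!: eventually_elim2)
    qed
    then have "AE z in circle_measure. \<forall>n. cut n z * rep_L2 (A x) z = cut n z * rep_L2 x z * \<psi> z"
      by (intro AE_all_countable[THEN iffD2] allI)
    with rep_mult_op[OF eb, of x] show ?thesis
      unfolding L2_eq_iff
    proof eventually_elim
      case (elim z)
      obtain n where "cmod (rep_L2 x z) \<le> real n" using real_arch_simple by blast
      then show ?case using elim(1) elim(2)[rule_format, of n] by (simp add: cut_def)
    qed
  qed
  then show thesis using that[OF eb] by blast
qed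

end

section \<open>Antilinear operators intertwining the shift and its adjoint\<close>

lemma bounded_antilinear_intertwining_eq:
  assumes "bounded_antilinear D"
    and intertwine: "\<And>x. mult_op (\<lambda>z. z) (D x) = D (mult_op cnj x)"
  obtains \<psi> where "ess_bounded \<psi>" "D = mult_op \<psi> \<circ> J_tilde"
proof -
  have add: "D (x + y) = D x + D y" and sc: "D (c *\<^sub>C x) = cnj c *\<^sub>C D x" for x y c
    using assms(1) by (auto simp: bounded_antilinear_def antilinear_def)
  have Jadd: "J_tilde (x + y) = J_tilde x + J_tilde y"
    and Jsc: "J_tilde (c *\<^sub>C x) = cnj c *\<^sub>C J_tilde x" for x y c
    using antilinear_J_tilde by (auto simp: antilinear_def)
  obtain K where K: "\<And>x. norm (D x) \<le> K * norm x"
    using assms(1) by (auto simp: bounded_antilinear_def)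
  interpret shift_commuting "D \<circ> J_tilde"
  proof (rule shift_commuting.intro)
    show "bounded_linear (D \<circ> J_tilde)"
    proof (rule bounded_linear_intro)
      show "norm ((D \<circ> J_tilde) x) \<le> norm x * K" for x
        using K[of "J_tilde x"] by (simp add: norm_J_tilde mult.commute)
      show "(D \<circ> J_tilde) (r *\<^sub>R x) = r *\<^sub>R (D \<circ> J_tilde) x" for r x
        by (simp add: scaleC_of_real[symmetric] sc Jsc)
    qed (simp add: add Jadd)
  qed (simp_all add: sc Jsc J_tilde_mult_op_z intertwine)
  obtain \<psi> where \<psi>: "ess_bounded \<psi>" "D \<circ> J_tilde = mult_op \<psi>" by (rule is_mult_op)
  have "D = mult_op \<psi> \<circ> J_tilde"
    by (simp add: \<psi>(2)[symmetric] fun_eq_iff J_tilde_J_tilde)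
  with \<psi>(1) show thesis by (rule that)
qed

lemma mult_op_J_tilde_intertwining:
  assumes "ess_bounded \<psi>"
  shows "mult_op \<psi> (J_tilde (mult_op cnj x)) = mult_op (\<lambda>z. z) (mult_op \<psi> (J_tilde x))"
  using mult_op_mult[OF assms ess_bounded_id, of "J_tilde x"]
    mult_op_mult[OF ess_bounded_id assms, of "J_tilde x"]
  by (simp add: J_tilde_mult_op_zbar mult.commute)

section \<open>Conjugations given by a symmetric matrix of symbols\<close>

text \<open>
  Applying this twice computes the square of a block operator: the second conjugation turns the
  conjugated arguments back and conjugates the inner symbols.
\<close>

lemma rep_row:
  assumes "ess_bounded \<phi>" "ess_bounded \<psi>"
  shows "AE z in circle_measure. rep_L2 (mult_op \<phi> (J_tilde f) + mult_op \<psi> (J_tilde g)) z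
    = \<phi> z * cnj (rep_L2 f z) + \<psi> z * cnj (rep_L2 g z)"
  using rep_plus[of "mult_op \<phi> (J_tilde f)" "mult_op \<psi> (J_tilde g)"]
    rep_mult_op[OF assms(1), of "J_tilde f"] rep_mult_op[OF assms(2), of "J_tilde g"]
    rep_J_tilde[of f] rep_J_tilde[of g]
  by eventually_elim simp

text \<open>
  The isometry law is \<open>cinner (C f) (C g) = cnj (cinner f (C (C g))) = cnj (cinner f g)\<close>.
\<close>

lemma conjugation_if_self_adjoint_involution:
  assumes "antilinear C" "\<And>f. C (C f) = f" "\<And>f g. cinner (C f) g = cnj (cinner f (C g))"
  shows "conjugation C"
  using assms(1,2) assms(3)[of _ "C _"] cinner_commute by (metis conjugation_def)

locale symbol_matrix =
  fixes \<psi>1 \<psi>2 \<psi>4 :: "complex \<Rightarrow> complex"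
  assumes bounded1: "ess_bounded \<psi>1" and bounded2: "ess_bounded \<psi>2" and bounded4: "ess_bounded \<psi>4"
begin

definition block :: "L2 \<times> L2 \<Rightarrow> L2 \<times> L2" where
  "block = block_op (mult_op \<psi>1 \<circ> J_tilde) (mult_op \<psi>2 \<circ> J_tilde) (mult_op \<psi>2 \<circ> J_tilde) (mult_op \<psi>4 \<circ> J_tilde)"

lemma block_eq: "block (f, g) = (mult_op \<psi>1 (J_tilde f) + mult_op \<psi>2 (J_tilde g),
    mult_op \<psi>2 (J_tilde f) + mult_op \<psi>4 (J_tilde g))"
  by (simp add: block_def block_op_def)

lemma rep_block_block:
  "AE z in circle_measure.
    rep_L2 (fst (block (block (f, g)))) z
      = (\<psi>1 z * cnj (\<psi>1 z) + \<psi>2 z * cnj (\<psi>2 z)) * rep_L2 f z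
        + (\<psi>1 z * cnj (\<psi>2 z) + \<psi>2 z * cnj (\<psi>4 z)) * rep_L2 g z \<and>
    rep_L2 (snd (block (block (f, g)))) z
      = (\<psi>2 z * cnj (\<psi>1 z) + \<psi>4 z * cnj (\<psi>2 z)) * rep_L2 f z
        + (\<psi>2 z * cnj (\<psi>2 z) + \<psi>4 z * cnj (\<psi>4 z)) * rep_L2 g z"
  unfolding block_eq fst_conv snd_conv
  using rep_row[OF bounded1 bounded2, of f g] rep_row[OF bounded2 bounded4, of f g]
    rep_row[OF bounded1 bounded2, of "mult_op \<psi>1 (J_tilde f) + mult_op \<psi>2 (J_tilde g)"
      "mult_op \<psi>2 (J_tilde f) + mult_op \<psi>4 (J_tilde g)"]
    rep_row[OF bounded2 bounded4, of "mult_op \<psi>1 (J_tilde f) + mult_op \<psi>2 (J_tilde g)"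
      "mult_op \<psi>2 (J_tilde f) + mult_op \<psi>4 (J_tilde g)"]
  by eventually_elim (simp add: algebra_simps)

abbreviation symbol_equations :: "complex \<Rightarrow> bool" where
  "symbol_equations z \<equiv> (cmod (\<psi>1 z))\<^sup>2 = (cmod (\<psi>4 z))\<^sup>2 \<and> (cmod (\<psi>4 z))\<^sup>2 = 1 - (cmod (\<psi>2 z))\<^sup>2 \<and>
          cnj (\<psi>1 z) * \<psi>2 z + cnj (\<psi>2 z) * \<psi>4 z = 0"

text \<open>
  The right-hand side says that the matrix of symbols times its entrywise conjugate is the identity.
  Its off-diagonal entries are conjugate to each other, so they amount to a single equation.
\<close>

lemma symbol_equations_iff:
  "symbol_equations z \<longleftrightarrow>
     \<psi>1 z * cnj (\<psi>1 z) + \<psi>2 z * cnj (\<psi>2 z) = 1 \<and> \<psi>1 z * cnj (\<psi>2 z) + \<psi>2 z * cnj (\<psi>4 z) = 0 \<and>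
     \<psi>2 z * cnj (\<psi>1 z) + \<psi>4 z * cnj (\<psi>2 z) = 0 \<and> \<psi>2 z * cnj (\<psi>2 z) + \<psi>4 z * cnj (\<psi>4 z) = 1"
proof -
  have diag: "a * cnj a + b * cnj b = 1 \<longleftrightarrow> (cmod a)\<^sup>2 + (cmod b)\<^sup>2 = 1" for a b
    unfolding complex_norm_square[symmetric] by (metis of_real_1 of_real_add of_real_eq_iff)
  have "\<psi>1 z * cnj (\<psi>2 z) + \<psi>2 z * cnj (\<psi>4 z) = cnj (cnj (\<psi>1 z) * \<psi>2 z + cnj (\<psi>2 z) * \<psi>4 z)"
    by simp
  then have "\<psi>1 z * cnj (\<psi>2 z) + \<psi>2 z * cnj (\<psi>4 z) = 0 \<longleftrightarrow> cnj (\<psi>1 z) * \<psi>2 z + cnj (\<psi>2 z) * \<psi>4 z = 0"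
    by (simp only: complex_cnj_zero_iff)
  then show ?thesis unfolding diag by (auto simp: mult.commute simp del: power2_eq_iff_nonneg)
qed

text \<open>
  Evaluating the square at the constant vectors \<open>(1, 0)\<close> and \<open>(0, 1)\<close> reads off the columns of the
  product matrix.
\<close>

lemma block_involution_iff: "(\<forall>p. block (block p) = p) \<longleftrightarrow> (AE z in circle_measure. symbol_equations z)"
proof
  assume inv: "\<forall>p. block (block p) = p"
  obtain e where rep_e: "AE z in circle_measure. rep_L2 e z = 1"
    by (rule ex_rep_L2_one)
  show "AE z in circle_measure. symbol_equations z"
    using rep_block_block[of e 0] rep_block_block[of 0 e] rep_e rep_zero
    unfolding symbol_equations_iff inv[rule_format] fst_conv snd_conv
    by eventually_elim auto
next
  assume eqs: "AE z in circle_measure. symbol_equations z"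
  have "block (block (f, g)) = (f, g)" for f g
  proof -
    have "AE z in circle_measure. rep_L2 (fst (block (block (f, g)))) z = rep_L2 f z \<and>
        rep_L2 (snd (block (block (f, g)))) z = rep_L2 g z"
      using eqs rep_block_block[of f g] unfolding symbol_equations_iff by eventually_elim simp
    then show ?thesis by (simp add: prod_eq_iff L2_eq_iff)
  qed
  then show "\<forall>p. block (block p) = p" by auto
qed

lemma block_self_adjoint: "cinner (block p) q = cnj (cinner p (block q))"
proof -
  have adj: "cinner (mult_op \<psi> (J_tilde f)) g = cnj (cinner f (mult_op \<psi> (J_tilde g)))"
    if "ess_bounded \<psi>" for \<psi> f g
    using antilinear_adjoint_mult_op_J_tilde[OF that] by (simp add: is_antilinear_adjoint_def)
  have add_right: "cinner x (y + z) = cinner x y + cinner x z" for x y z :: L2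
    by (metis cinner_add_left cinner_commute complex_cnj_add)
  show ?thesis
    by (cases p; cases q)
      (simp add: block_eq cinner_prod_def cinner_add_left add_right adj bounded1 bounded2 bounded4)
qed

lemma block_intertwining: "M_z \<circ> block = block \<circ> M_zbar"
  by (auto simp: fun_eq_iff M_z_def M_zbar_def block_eq mult_op_J_tilde_intertwining mult_op_add_right
      ess_bounded_id bounded1 bounded2 bounded4)

end

lemma antilinear_adjoint_eqI: "is_antilinear_adjoint A B \<Longrightarrow> A\<^sup>\<sharp> = B"
  unfolding antilinear_adjoint_def using is_antilinear_adjoint_unique by (intro the_equality) auto

theorem theorem2p5:
  fixes C :: "L2 \<times> L2 \<Rightarrow> L2 \<times> L2" and D1 D2 D4 :: "L2 \<Rightarrow> L2"
  assumes "antilinear C"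
    and "bounded_antilinear D1" and "bounded_antilinear D2" and "bounded_antilinear D4"
    and "C = block_op D1 D2 (D2\<^sup>\<sharp>) D4"
  shows "conjugation C \<and> M_z \<circ> C = C \<circ> M_zbar \<longleftrightarrow>
    (\<exists>\<psi>1 \<psi>2 \<psi>4. ess_bounded \<psi>1 \<and> ess_bounded \<psi>2 \<and> ess_bounded \<psi>4 \<and>
       D1 = mult_op \<psi>1 \<circ> J_tilde \<and> D2 = mult_op \<psi>2 \<circ> J_tilde \<and> D4 = mult_op \<psi>4 \<circ> J_tilde \<and>
       (AE z in circle_measure.
          (cmod (\<psi>1 z))\<^sup>2 = (cmod (\<psi>4 z))\<^sup>2 \<and> (cmod (\<psi>4 z))\<^sup>2 = 1 - (cmod (\<psi>2 z))\<^sup>2 \<and>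
          cnj (\<psi>1 z) * \<psi>2 z + cnj (\<psi>2 z) * \<psi>4 z = 0))"
    (is "?conj \<longleftrightarrow> ?symbols")
proof
  assume ?conj
  then have inv: "\<And>p. C (C p) = p" and int: "\<And>p. M_z (C p) = C (M_zbar p)"
    by (auto simp: conjugation_def fun_eq_iff)
  have mult0: "mult_op \<psi> 0 = 0" if "ess_bounded \<psi>" for \<psi>
    using mult_op_add_right[OF that, of 0 0] by simp
  have zero: "D 0 = 0" if "bounded_antilinear D" for D :: "L2 \<Rightarrow> L2"
    using that unfolding bounded_antilinear_def antilinear_def by (metis add_cancel_right_right add_0)
  note D0 = zero[OF assms(2)] zero[OF assms(3)] zero[OF assms(4)]
  have i1: "mult_op (\<lambda>z. z) (D1 x) = D1 (mult_op cnj x)" for x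
    using int[of "(x, 0)"]
    by (simp add: assms(5) block_op_def M_z_def M_zbar_def mult0 ess_bounded_cnj D0)
  have i2: "mult_op (\<lambda>z. z) (D2 x) = D2 (mult_op cnj x)" for x
    using int[of "(0, x)"]
    by (simp add: assms(5) block_op_def M_z_def M_zbar_def mult0 ess_bounded_cnj D0)
  obtain \<psi>1 where 1: "ess_bounded \<psi>1" "D1 = mult_op \<psi>1 \<circ> J_tilde"
    by (rule bounded_antilinear_intertwining_eq[OF assms(2) i1])
  obtain \<psi>2 where 2: "ess_bounded \<psi>2" "D2 = mult_op \<psi>2 \<circ> J_tilde"
    by (rule bounded_antilinear_intertwining_eq[OF assms(3) i2])
  have D2_adj: "D2\<^sup>\<sharp> = D2"
    unfolding 2(2) by (rule antilinear_adjoint_eqI[OF antilinear_adjoint_mult_op_J_tilde[OF 2(1)]])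
  \<comment> \<open>the second component of \<open>C (0, x)\<close> is \<open>D2\<^sup>\<sharp> 0 + D4 x\<close>, so \<open>D2\<^sup>\<sharp>\<close> has to be identified before \<open>D4\<close>\<close>
  have i4: "mult_op (\<lambda>z. z) (D4 x) = D4 (mult_op cnj x)" for x
    using int[of "(0, x)"]
    by (simp add: assms(5) block_op_def M_z_def M_zbar_def mult0 ess_bounded_cnj D0 D2_adj)
  obtain \<psi>4 where 4: "ess_bounded \<psi>4" "D4 = mult_op \<psi>4 \<circ> J_tilde"
    by (rule bounded_antilinear_intertwining_eq[OF assms(4) i4])
  interpret symbol_matrix \<psi>1 \<psi>2 \<psi>4
    by standard (fact 1 2 4)+
  have "C = block"
    unfolding assms(5) D2_adj unfolding block_def 1(2) 2(2) 4(2) ..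
  then have "AE z in circle_measure. symbol_equations z"
    using inv by (intro block_involution_iff[THEN iffD1]) simp
  with 1 2 4 show ?symbols by blast
next
  assume ?symbols
  then obtain \<psi>1 \<psi>2 \<psi>4 where b: "ess_bounded \<psi>1" "ess_bounded \<psi>2" "ess_bounded \<psi>4"
    and D: "D1 = mult_op \<psi>1 \<circ> J_tilde" "D2 = mult_op \<psi>2 \<circ> J_tilde" "D4 = mult_op \<psi>4 \<circ> J_tilde"
    and eqs: "AE z in circle_measure.
          (cmod (\<psi>1 z))\<^sup>2 = (cmod (\<psi>4 z))\<^sup>2 \<and> (cmod (\<psi>4 z))\<^sup>2 = 1 - (cmod (\<psi>2 z))\<^sup>2 \<and>
          cnj (\<psi>1 z) * \<psi>2 z + cnj (\<psi>2 z) * \<psi>4 z = 0" by blast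
  interpret symbol_matrix \<psi>1 \<psi>2 \<psi>4
    by standard (fact b)+
  have D2_adj: "D2\<^sup>\<sharp> = D2"
    unfolding D(2) by (rule antilinear_adjoint_eqI[OF antilinear_adjoint_mult_op_J_tilde[OF b(2)]])
  have C: "C = block"
    unfolding assms(5) D2_adj unfolding block_def D ..
  have "\<And>p. C (C p) = p"
    unfolding C using block_involution_iff[THEN iffD2, OF eqs] by blast
  moreover have "\<And>p q. cinner (C p) q = cnj (cinner p (C q))"
    unfolding C by (rule block_self_adjoint)
  ultimately have "conjugation C"
    by (rule conjugation_if_self_adjoint_involution[OF assms(1)])
  then show ?conj using block_intertwining by (simp add: C)
qed

end
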